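(* Let $BES=\langle\mathcal{B},\mathcal{R}\rangle$ be a Boolean evolution system with variables $b_1,\dots,b_n$ and let $\mathcal{M}$ be its transition system. The first category of inconsistency can be checked by the CTL formula $$AG\big(\neg(EX\,\mathtt{B}_1\land EX\,\mathtt{D}_1)\land\cdots\land\neg(EX\,\mathtt{B}_n\land EX\,\mathtt{D}_n)\big),$$ that is, this formula holds in $\mathcal{M}$ (at all initial states) if and only if the first category of inconsistency does not occur in $BES$.
   Context: A Boolean evolution system $BES=\langle\mathcal{B},\mathcal{R}\rangle$ consists of a finite set of variables $\mathcal{B}=\{b_1,\dots,b_n\}$, $n=n_1+n_2$, with $\mathcal{B}^{unknown}=\{b_1,\dots,b_{n_1}\}$ and $\mathcal{B}^{known}=\{b_{n_1+1},\dots,b_{n_1+n_2}\}$, and a finite set $\mathcal{R}$ of rules, each of the form $g\to b$ (assign $true$ to $b$) or $g\to\neg b$ (assign $false$ to $b$), where $g$ (the guard) is a Boolean formula over $\mathcal{B}$ and $b\in\mathcal{B}$. A valuation gives each known variable a value in $\{true,false\}$ and each unknown variable a value in $\{true,false,unknown\}$. Guards are evaluated to $true$, $false$ or $unknown$ (strong Kleene three-valued logic); a rule is enabled at a valuation if its guard evaluates to $true$. It is assumed that at each valuation the set of enabled rules is non-empty. The transition system $\mathcal{M}=\langle S,S_0,T,A,H\rangle$ of $BES$: $S$ is the set of all $3^{n_1}\cdot 2^{n_2}$ valuations; $S_0$ is the set of the $2^{n_2}$ valuations in which all unknown variables have value $unknown$; $(s,s')\in T$ iff $s'$ results from $s$ by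 simultaneously applying all enabled rules (synchronous semantics): for each variable $b$, $s'(b)=s(b)$ if no enabled rule assigns $b$; $s'(b)=true$ (resp. $false$) if some enabled rule is of the form $g\to b$ (resp. $g\to\neg b$) and no enabled rule assigns the opposite value; and if enabled rules of both forms exist for $b$, then $s'(b)$ may be either $true$ or $false$ (so $k$ conflicting variables give $2^k$ successors). Atomic propositions include $\mathtt{B}_i$, holding in $s$ iff $s(b_i)=true$, and $\mathtt{D}_i$, holding in $s$ iff $s(b_i)=false$. First category of inconsistency: at some time during an evolution from an initial state (i.e. in some state reachable from $S_0$), two enabled rules try to update the same variable with opposite values. CTL has the standard semantics over (infinite) paths of $\mathcal{M}$; a formula holds in $\mathcal{M}$ if it is satisfied at every state of $S_0$. *)

theory Defs
  imports "HOL-Library.FuncSet"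
begin

section \<open>Transition systems and CTL\<close>

record ('s, 'a) transition_system =
  states :: "'s set"
  inits :: "'s set"
  trans_rel :: "('s \<times> 's) set"
  props :: "'a set"
  labels :: "'s \<Rightarrow> 'a set"

datatype 'a ctl =
    CTrue
  | CAtom 'a
  | CNot "'a ctl"
  | CAnd "'a ctl" "'a ctl"
  | COr "'a ctl" "'a ctl"
  | CEX "'a ctl"
  | CAX "'a ctl"
  | CEF "'a ctl"
  | CAF "'a ctl"
  | CEG "'a ctl"
  | CAG "'a ctl"
  | CEU "'a ctl" "'a ctl"
  | CAU "'a ctl" "'a ctl"

text \<open>The empty conjunction is true.\<close>

fun ctl_conj :: "'a ctl list \<Rightarrow> 'a ctl" where
  "ctl_conj [] = CTrue"
| "ctl_conj [\<phi>] = \<phi>"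
| "ctl_conj (\<phi> # \<phi>' # \<phi>s) = CAnd \<phi> (ctl_conj (\<phi>' # \<phi>s))"

definition paths :: "('s, 'a) transition_system \<Rightarrow> 's \<Rightarrow> (nat \<Rightarrow> 's) set" where
  "paths M s = {\<pi>. \<pi> 0 = s \<and> (\<forall>k. (\<pi> k, \<pi> (Suc k)) \<in> trans_rel M)}"

primrec sat :: "('s, 'a) transition_system \<Rightarrow> 's \<Rightarrow> 'a ctl \<Rightarrow> bool" where
  "sat M s CTrue \<longleftrightarrow> True"
| "sat M s (CAtom a) \<longleftrightarrow> a \<in> labels M s"
| "sat M s (CNot \<phi>) \<longleftrightarrow> \<not> sat M s \<phi>"
| "sat M s (CAnd \<phi> \<psi>) \<longleftrightarrow> sat M s \<phi> \<and> sat M s \<psi>"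
| "sat M s (COr \<phi> \<psi>) \<longleftrightarrow> sat M s \<phi> \<or> sat M s \<psi>"
| "sat M s (CEX \<phi>) \<longleftrightarrow> (\<exists>\<pi>\<in>paths M s. sat M (\<pi> 1) \<phi>)"
| "sat M s (CAX \<phi>) \<longleftrightarrow> (\<forall>\<pi>\<in>paths M s. sat M (\<pi> 1) \<phi>)"
| "sat M s (CEF \<phi>) \<longleftrightarrow> (\<exists>\<pi>\<in>paths M s. \<exists>k. sat M (\<pi> k) \<phi>)"
| "sat M s (CAF \<phi>) \<longleftrightarrow> (\<forall>\<pi>\<in>paths M s. \<exists>k. sat M (\<pi> k) \<phi>)"
| "sat M s (CEG \<phi>) \<longleftrightarrow> (\<exists>\<pi>\<in>paths M s. \<forall>k. sat M (\<pi> k) \<phi>)"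
| "sat M s (CAG \<phi>) \<longleftrightarrow> (\<forall>\<pi>\<in>paths M s. \<forall>k. sat M (\<pi> k) \<phi>)"
| "sat M s (CEU \<phi> \<psi>) \<longleftrightarrow>
     (\<exists>\<pi>\<in>paths M s. \<exists>k. sat M (\<pi> k) \<psi> \<and> (\<forall>j<k. sat M (\<pi> j) \<phi>))"
| "sat M s (CAU \<phi> \<psi>) \<longleftrightarrow>
     (\<forall>\<pi>\<in>paths M s. \<exists>k. sat M (\<pi> k) \<psi> \<and> (\<forall>j<k. sat M (\<pi> j) \<phi>))"

definition holds_in :: "('s, 'a) transition_system \<Rightarrow> 'a ctl \<Rightarrow> bool" where
  "holds_in M \<phi> \<longleftrightarrow> (\<forall>s\<in>inits M. sat M s \<phi>)"


section \<open>Strong Kleene logic\<close>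

datatype tval = Tt | Ff | Unknown

fun of_bool3 :: "bool \<Rightarrow> tval" where
  "of_bool3 True = Tt"
| "of_bool3 False = Ff"

fun not3 :: "tval \<Rightarrow> tval" where
  "not3 Tt = Ff"
| "not3 Ff = Tt"
| "not3 Unknown = Unknown"

fun and3 :: "tval \<Rightarrow> tval \<Rightarrow> tval" where
  "and3 Ff y = Ff"
| "and3 x Ff = Ff"
| "and3 Tt Tt = Tt"
| "and3 x y = Unknown"

fun or3 :: "tval \<Rightarrow> tval \<Rightarrow> tval" where
  "or3 Tt y = Tt"
| "or3 x Tt = Tt"
| "or3 Ff Ff = Ff"
| "or3 x y = Unknown"

datatype guard =
    GConst bool
  | GVar nat
  | GNot guard
  | GAnd guard guard
  | GOr guard guard

primrec guard_vars :: "guard \<Rightarrow> nat set" where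
  "guard_vars (GConst c) = {}"
| "guard_vars (GVar i) = {i}"
| "guard_vars (GNot g) = guard_vars g"
| "guard_vars (GAnd g h) = guard_vars g \<union> guard_vars h"
| "guard_vars (GOr g h) = guard_vars g \<union> guard_vars h"

primrec guard_val :: "(nat \<Rightarrow> tval) \<Rightarrow> guard \<Rightarrow> tval" where
  "guard_val s (GConst c) = of_bool3 c"
| "guard_val s (GVar i) = s i"
| "guard_val s (GNot g) = not3 (guard_val s g)"
| "guard_val s (GAnd g h) = and3 (guard_val s g) (guard_val s h)"
| "guard_val s (GOr g h) = or3 (guard_val s g) (guard_val s h)"


section \<open>Boolean evolution systems\<close>

text \<open>The variable \<open>b\<^sub>i\<close> is represented by its index \<open>i\<close>. The rule \<open>g \<rightarrow> b\<^sub>i\<close> is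
  \<open>Rule g i True\<close>, and \<open>g \<rightarrow> \<not> b\<^sub>i\<close> is \<open>Rule g i False\<close>.\<close>

datatype rule = Rule (rguard: guard) (rtarget: nat) (rvalue: bool)

record bes =
  num_unknown :: nat
  num_known :: nat
  rules :: "rule set"

definition num_vars :: "bes \<Rightarrow> nat" where
  "num_vars E = num_unknown E + num_known E"

definition unknown_vars :: "bes \<Rightarrow> nat set" where
  "unknown_vars E = {1..num_unknown E}"

definition known_vars :: "bes \<Rightarrow> nat set" where
  "known_vars E = {num_unknown E + 1..num_unknown E + num_known E}"

definition bes_vars :: "bes \<Rightarrow> nat set" where
  "bes_vars E = unknown_vars E \<union> known_vars E"

text \<open>Valuations are extensional (undefined outside the variables), so that there are
  only finitely many of them.\<close>

definition valuations :: "bes \<Rightarrow> (nat \<Rightarrow> tval) set" where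
  "valuations E = (\<Pi>\<^sub>E i\<in>bes_vars E. if i \<in> unknown_vars E then {Tt, Ff, Unknown} else {Tt, Ff})"

lemma card_valuations: "card (valuations E) = 3 ^ num_unknown E * 2 ^ num_known E"
proof -
  have "known_vars E \<inter> unknown_vars E = {}" by (auto simp: known_vars_def unknown_vars_def)
  then have "card (valuations E) = (\<Prod>i\<in>unknown_vars E. 3) * (\<Prod>i\<in>known_vars E. 2)"
    unfolding valuations_def bes_vars_def
    by (subst card_PiE, simp add: unknown_vars_def known_vars_def, subst Un_commute, subst prod.union_disjoint)
      (auto simp: known_vars_def unknown_vars_def numeral_eq_Suc)
  then show ?thesis by (simp add: known_vars_def unknown_vars_def numeral_eq_Suc)
qed

definition enabled :: "bes \<Rightarrow> (nat \<Rightarrow> tval) \<Rightarrow> rule set" where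
  "enabled E s = {r \<in> rules E. guard_val s (rguard r) = Tt}"

definition wf_bes :: "bes \<Rightarrow> bool" where
  "wf_bes E \<longleftrightarrow>
     finite (rules E) \<and>
     (\<forall>r\<in>rules E. guard_vars (rguard r) \<subseteq> bes_vars E \<and> rtarget r \<in> bes_vars E) \<and>
     (\<forall>s\<in>valuations E. enabled E s \<noteq> {})"

definition assigned :: "bes \<Rightarrow> (nat \<Rightarrow> tval) \<Rightarrow> nat \<Rightarrow> bool \<Rightarrow> bool" where
  "assigned E s i v \<longleftrightarrow> (\<exists>r\<in>enabled E s. rtarget r = i \<and> rvalue r = v)"

definition next_values :: "bes \<Rightarrow> (nat \<Rightarrow> tval) \<Rightarrow> nat \<Rightarrow> tval set" where
  "next_values E s i =
     (if assigned E s i True \<and> assigned E s i False then {Tt, Ff}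
      else if assigned E s i True then {Tt}
      else if assigned E s i False then {Ff}
      else {s i})"

text \<open>\<open>PropB i\<close> and \<open>PropD i\<close> state that \<open>b\<^sub>i\<close> is true and false, respectively.\<close>

datatype prop_atom = PropB nat | PropD nat

definition bes_ts :: "bes \<Rightarrow> (nat \<Rightarrow> tval, prop_atom) transition_system" where
  "bes_ts E = \<lparr>
     states = valuations E,
     inits = {s \<in> valuations E. \<forall>i\<in>unknown_vars E. s i = Unknown},
     trans_rel = {(s, s'). s \<in> valuations E \<and> s' \<in> valuations E \<and>
                           (\<forall>i\<in>bes_vars E. s' i \<in> next_values E s i)},
     props = PropB ` bes_vars E \<union> PropD ` bes_vars E,
     labels = (\<lambda>s. {PropB i | i. i \<in> bes_vars E \<and> s i = Tt} \<union>
                   {PropD i | i. i \<in> bes_vars E \<and> s i = Ff})\<rparr>"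

definition reachable :: "bes \<Rightarrow> (nat \<Rightarrow> tval) set" where
  "reachable E = {s. \<exists>s0\<in>inits (bes_ts E). (s0, s) \<in> (trans_rel (bes_ts E))\<^sup>*}"

definition first_category_inconsistency :: "bes \<Rightarrow> bool" where
  "first_category_inconsistency E \<longleftrightarrow>
     (\<exists>s\<in>reachable E. \<exists>r\<in>enabled E s. \<exists>r'\<in>enabled E s.
        rtarget r = rtarget r' \<and> rvalue r \<noteq> rvalue r')"

definition consistency_formula :: "nat \<Rightarrow> prop_atom ctl" where
  "consistency_formula n =
     CAG (ctl_conj (map (\<lambda>i. CNot (CAnd (CEX (CAtom (PropB i))) (CEX (CAtom (PropD i))))) [1..<n + 1]))"

end

theory Submission
  imports Defs
begin

text \<open>Since a variable's next value is chosen independently of the others, \<open>EX B\<^sub>i \<and> EX D\<^sub>i\<close> holds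
  at a valuation iff both \<open>true\<close> and \<open>false\<close> are possible next values of \<open>b\<^sub>i\<close>, which happens
  exactly when enabled rules conflict on \<open>b\<^sub>i\<close>. The transition relation is serial on
  valuations, so every finite evolution extends to an infinite path and the path quantifiers
  \<open>EX\<close> and \<open>AG\<close> reduce to one-step successors and reachable states.\<close>

text \<open>The inclusion keeps successors inside \<open>states M\<close>, so totality there can be
  applied again and again.\<close>

definition serial_ts :: "('s, 'a) transition_system \<Rightarrow> bool" where
  "serial_ts M \<longleftrightarrow>
     trans_rel M \<subseteq> states M \<times> states M \<and> (\<forall>s\<in>states M. \<exists>t. (s, t) \<in> trans_rel M)"

lemma paths_nonempty:
  assumes "serial_ts M" and "s \<in> states M"
  obtains \<pi> where "\<pi> \<in> paths M s"
proof -
  \<comment> \<open>Dependent choice leaves the first element open; the clause for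
    \<open>k = 0\<close> pins it to \<open>s\<close>.\<close>
  have "\<exists>\<pi>. \<forall>k. (\<pi> k \<in> states M \<and> (k = 0 \<longrightarrow> \<pi> k = s)) \<and> (\<pi> k, \<pi> (Suc k)) \<in> trans_rel M"
    by (rule dependent_nat_choice) (use assms in \<open>fastforce simp: serial_ts_def\<close>)+
  then show thesis
    using that by (auto simp: paths_def)
qed

lemma path_Cons:
  assumes "(s, t) \<in> trans_rel M" and "\<pi> \<in> paths M t"
  shows "case_nat s \<pi> \<in> paths M s"
  using assms by (auto simp: paths_def split: nat.split)

text \<open>Paths grow by prepending, so the induction peels off the first transition; the infinite
  tail after \<open>t\<close> comes from \<open>paths_nonempty\<close>.\<close>

lemma path_through_reachable:
  assumes "serial_ts M" and "s \<in> states M" and "(s, t) \<in> (trans_rel M)\<^sup>*"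
  shows "\<exists>\<pi>\<in>paths M s. \<exists>k. \<pi> k = t"
  using assms(3,2)
proof (induction rule: converse_rtrancl_induct)
  case base
  then obtain \<pi> where "\<pi> \<in> paths M t"
    using paths_nonempty[OF assms(1)] by blast
  then show ?case
    by (auto simp: paths_def)
next
  case (step s u)
  then have "u \<in> states M"
    using assms(1) by (auto simp: serial_ts_def)
  with step obtain \<pi> k where "\<pi> \<in> paths M u" "\<pi> k = t"
    by blast
  then have "case_nat s \<pi> \<in> paths M s" "case_nat s \<pi> (Suc k) = t"
    using step.hyps(1) by (auto intro: path_Cons)
  then show ?case
    by blast
qed

lemma path_reachable:
  assumes "\<pi> \<in> paths M s"
  shows "(s, \<pi> k) \<in> (trans_rel M)\<^sup>*"
  using assms by (induction k) (auto simp: paths_def intro: rtrancl_into_rtrancl)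

lemma sat_CAG_iff:
  assumes "serial_ts M" and "s \<in> states M"
  shows "sat M s (CAG \<phi>) \<longleftrightarrow> (\<forall>t. (s, t) \<in> (trans_rel M)\<^sup>* \<longrightarrow> sat M t \<phi>)"
  using path_through_reachable[OF assms] path_reachable by fastforce

text \<open>A successor witnesses \<open>CEX\<close> only if it lies on an infinite path; seriality
  supplies one, prefixed by \<open>s\<close>.\<close>

lemma sat_CEX_iff:
  assumes "serial_ts M"
  shows "sat M s (CEX \<phi>) \<longleftrightarrow> (\<exists>t. (s, t) \<in> trans_rel M \<and> sat M t \<phi>)"
proof
  assume "sat M s (CEX \<phi>)"
  then show "\<exists>t. (s, t) \<in> trans_rel M \<and> sat M t \<phi>"
    by (force simp: paths_def)
next
  assume "\<exists>t. (s, t) \<in> trans_rel M \<and> sat M t \<phi>"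
  then obtain t where t: "(s, t) \<in> trans_rel M" "sat M t \<phi>"
    by blast
  then have "t \<in> states M"
    using assms by (auto simp: serial_ts_def)
  then obtain \<pi> where \<pi>: "\<pi> \<in> paths M t"
    using paths_nonempty[OF assms] by blast
  then have "case_nat s \<pi> \<in> paths M s" "case_nat s \<pi> 1 = t"
    using path_Cons[OF t(1)] by (auto simp: paths_def)
  then show "sat M s (CEX \<phi>)"
    using t(2) by (metis sat.simps(6))
qed

lemma sat_ctl_conj: "sat M s (ctl_conj \<phi>s) \<longleftrightarrow> (\<forall>\<phi>\<in>set \<phi>s. sat M s \<phi>)"
  by (induction \<phi>s rule: ctl_conj.induct) auto

lemma next_values_nonempty: "next_values E s i \<noteq> {}"
  by (simp add: next_values_def)

text \<open>A next value is either Boolean, which every variable admits, or the old value, which is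
  admissible because \<open>s\<close> is a valuation.\<close>

lemma next_values_range:
  assumes "s \<in> valuations E" and "i \<in> bes_vars E" and "v \<in> next_values E s i"
  shows "v \<in> (if i \<in> unknown_vars E then {Tt, Ff, Unknown} else {Tt, Ff})"
proof -
  have "s i \<in> (if i \<in> unknown_vars E then {Tt, Ff, Unknown} else {Tt, Ff})"
    using assms(1,2) unfolding valuations_def by (rule PiE_mem)
  then show ?thesis
    using assms(3) by (auto simp: next_values_def split: if_splits)
qed

lemma ex_successor_with_value:
  assumes "s \<in> valuations E" and "i \<in> bes_vars E" and "v \<in> next_values E s i"
  shows "\<exists>t. (s, t) \<in> trans_rel (bes_ts E) \<and> t i = v"
proof -
  \<comment> \<open>Variables other than \<open>i\<close> take an arbitrary admissible next value;
    \<open>restrict\<close> makes \<open>t\<close> extensional, as valuations must be.\<close>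
  define t where "t = restrict ((\<lambda>j. SOME w. w \<in> next_values E s j)(i := v)) (bes_vars E)"
  have t: "t j \<in> next_values E s j" if "j \<in> bes_vars E" for j
    using that assms(3) next_values_nonempty by (auto simp: t_def some_in_eq)
  then have "t \<in> valuations E"
    using next_values_range[OF assms(1)] unfolding valuations_def
    by (intro PiE_I) (auto simp: t_def)
  then have "(s, t) \<in> trans_rel (bes_ts E)"
    using t assms(1) by (simp add: bes_ts_def)
  moreover have "t i = v"
    using assms(2) by (simp add: t_def)
  ultimately show ?thesis
    by blast
qed

lemma ex_successor_with_value_iff:
  assumes "s \<in> valuations E" and "i \<in> bes_vars E"
  shows "(\<exists>t. (s, t) \<in> trans_rel (bes_ts E) \<and> t i = v) \<longleftrightarrow> v \<in> next_values E s i"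
proof
  show "\<exists>t. (s, t) \<in> trans_rel (bes_ts E) \<and> t i = v \<Longrightarrow> v \<in> next_values E s i"
    using assms(2) by (auto simp: bes_ts_def)
qed (rule ex_successor_with_value[OF assms])

lemma serial_bes_ts:
  assumes "wf_bes E"
  shows "serial_ts (bes_ts E)"
  unfolding serial_ts_def
proof (intro conjI ballI)
  fix s assume "s \<in> states (bes_ts E)"
  then have s: "s \<in> valuations E"
    by (simp add: bes_ts_def)
  \<comment> \<open>The enabled rule serves only to exhibit a variable, its target, at which
    \<open>ex_successor_with_value\<close> can be applied.\<close>
  then obtain r where "r \<in> enabled E s"
    using assms unfolding wf_bes_def by blast
  then have "rtarget r \<in> bes_vars E"
    using assms by (auto simp: wf_bes_def enabled_def)
  then show "\<exists>t. (s, t) \<in> trans_rel (bes_ts E)"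
    using ex_successor_with_value[OF s] next_values_nonempty by blast
qed (auto simp: bes_ts_def)

lemma bes_vars_eq: "bes_vars E = {1..num_vars E}"
  by (auto simp: bes_vars_def unknown_vars_def known_vars_def num_vars_def)

text \<open>Every branch of \<open>next_values\<close> except the conflicting one is a
  singleton.\<close>

lemma both_next_values_iff:
  "Tt \<in> next_values E s i \<and> Ff \<in> next_values E s i \<longleftrightarrow> assigned E s i True \<and> assigned E s i False"
  by (auto simp: next_values_def)

lemma sat_EX_both_iff:
  assumes "wf_bes E" and "s \<in> valuations E" and "i \<in> bes_vars E"
  shows "sat (bes_ts E) s (CAnd (CEX (CAtom (PropB i))) (CEX (CAtom (PropD i)))) \<longleftrightarrow>
    assigned E s i True \<and> assigned E s i False"
proof -
  \<comment> \<open>Labels mention only indices in \<open>bes_vars E\<close>, hence the appeal to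
    the assumption on \<open>i\<close>.\<close>
  have "sat (bes_ts E) t (CAtom (PropB i)) \<longleftrightarrow> t i = Tt"
    "sat (bes_ts E) t (CAtom (PropD i)) \<longleftrightarrow> t i = Ff" for t
    using assms(3) by (auto simp: bes_ts_def)
  then show ?thesis
    using ex_successor_with_value_iff[OF assms(2,3)] both_next_values_iff
    by (simp only: sat.simps(4) sat_CEX_iff[OF serial_bes_ts[OF assms(1)]])
qed

lemma conflict_iff:
  assumes "wf_bes E"
  shows "(\<exists>r\<in>enabled E s. \<exists>r'\<in>enabled E s. rtarget r = rtarget r' \<and> rvalue r \<noteq> rvalue r') \<longleftrightarrow>
    (\<exists>i\<in>bes_vars E. assigned E s i True \<and> assigned E s i False)"
    (is "?L \<longleftrightarrow> ?R")
proof
  assume ?L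
  then obtain r r' where r: "r \<in> enabled E s" "r' \<in> enabled E s" "rtarget r = rtarget r'"
    "rvalue r \<noteq> rvalue r'"
    by blast
  then have "rtarget r \<in> bes_vars E"
    using assms by (auto simp: wf_bes_def enabled_def)
  \<comment> \<open>The value of \<open>r\<close> decides which of the two rules witnesses
    \<open>True\<close> and which \<open>False\<close>.\<close>
  moreover have "assigned E s (rtarget r) True \<and> assigned E s (rtarget r) False"
    using r unfolding assigned_def by (cases "rvalue r") auto
  ultimately show ?R
    by blast
next
  assume ?R
  then show ?L
    unfolding assigned_def by metis
qed

lemma reachable_valuation:
  assumes "s \<in> valuations E" and "(s, t) \<in> (trans_rel (bes_ts E))\<^sup>*"
  shows "t \<in> valuations E"
  using assms(2,1) by (induction rule: rtrancl_induct) (auto simp: bes_ts_def)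

theorem lemma1:
  fixes E :: bes
  assumes "wf_bes E"
  shows "holds_in (bes_ts E) (consistency_formula (num_vars E)) \<longleftrightarrow> \<not> first_category_inconsistency E"
proof -
  let ?M = "bes_ts E"
  let ?\<psi> = "ctl_conj (map (\<lambda>i. CNot (CAnd (CEX (CAtom (PropB i))) (CEX (CAtom (PropD i)))))
    [1..<num_vars E + 1])"
  let ?conflict = "\<lambda>t. \<exists>r\<in>enabled E t. \<exists>r'\<in>enabled E t.
    rtarget r = rtarget r' \<and> rvalue r \<noteq> rvalue r'"
  have inits: "s \<in> valuations E" if "s \<in> inits ?M" for s
    using that by (simp add: bes_ts_def)
  \<comment> \<open>Indices start at 1 and the upper bound of the list is exclusive.\<close>
  have vars: "set [1..<num_vars E + 1] = bes_vars E"
    by (auto simp: bes_vars_eq)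
  have \<psi>: "sat ?M t ?\<psi> \<longleftrightarrow> \<not> ?conflict t" if "t \<in> valuations E" for t
    unfolding sat_ctl_conj set_map vars conflict_iff[OF assms] ball_simps sat.simps(3)
    using sat_EX_both_iff[OF assms that] by blast
  have "sat ?M s (CAG ?\<psi>) \<longleftrightarrow> (\<forall>t. (s, t) \<in> (trans_rel ?M)\<^sup>* \<longrightarrow> \<not> ?conflict t)"
    if "s \<in> inits ?M" for s
  proof -
    have "s \<in> states ?M"
      using inits[OF that] by (simp add: bes_ts_def)
    then have "sat ?M s (CAG ?\<psi>) \<longleftrightarrow> (\<forall>t. (s, t) \<in> (trans_rel ?M)\<^sup>* \<longrightarrow> sat ?M t ?\<psi>)"
      by (rule sat_CAG_iff[OF serial_bes_ts[OF assms]])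
    then show ?thesis
      \<comment> \<open>\<open>\<psi>\<close> is characterised only at valuations, so reachable
        states must be known to be valuations.\<close>
      using \<psi> reachable_valuation[OF inits[OF that]] by blast
  qed
  then show ?thesis
    unfolding holds_in_def consistency_formula_def first_category_inconsistency_def reachable_def
    by blast
qed

end
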